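(* Let $D\ge 1$ and $N>2D$ be integers, let $q$ be a prime power, let $\Gamma=J_q(N,D)$, let $x$ be a vertex of $\Gamma$, and let $A^*=A^*(x)$ be the dual adjacency matrix. For every subspace $\alpha\subseteq x$, with $i=\dim\alpha$, $$A^*\alpha^{\vee}=\theta^*_{D-i}\,\alpha^{\vee}+\frac{q^{-D+i+1}[N][N-1]}{[D][N-D]}\sum_{\substack{\gamma\subseteq x,\\ \gamma\text{ covers }\alpha}}\gamma^{\vee}.$$
   Context: Let $\mathbb{F}_q$ be a finite field with $q$ elements and $\mathcal{V}$ an $N$-dimensional vector space over $\mathbb{F}_q$. The Grassmann graph $\Gamma=J_q(N,D)$ has vertex set $X$ consisting of the $D$-dimensional subspaces of $\mathcal{V}$; $y,z\in X$ are adjacent iff $\dim(y\cap z)=D-1$. For $N>2D$ it has diameter $D$ and path-length distance $\partial(y,z)=D-\dim(y\cap z)$. $[\ell]=\frac{q^\ell-1}{q-1}$ for integers $\ell$. The adjacency matrix $A$ has distinct eigenvalues $\theta_0>\theta_1>\cdots>\theta_D$; let $E_1$ be the orthogonal projection of $V=\mathbb{C}^X$ onto the $\theta_1$-eigenspace. The dual adjacency matrix $A^*=A^*(x)$ is the diagonal matrix with $(y,y)$-entry $|X|(E_1)_{x,y}$. One has $A^*=\sum_{i=0}^D\theta_i^*E_i^*$, where $E_i^*$ is the diagonal matrix with $(y,y)$-entry $1$ if $\partial(x,y)=i$ and $0$ otherwise, and the dual eigenvalues are $$\theta_i^*=-\frac{q[N-1]([D]+[N-D])}{(q-1)[D][N-D]}+\frac{q[N][N-1]}{(q-1)[D][N-D]}q^{-i}\qquad(0\le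 i\le D).$$ For subspaces $u,v$ of $\mathcal{V}$, $v$ covers $u$ means $u\subseteq v$ and $\dim v=\dim u+1$. For $y\in X$ let $\widehat y\in V$ have $1$ in coordinate $y$ and $0$ elsewhere. For a subspace $\alpha\subseteq x$, $\alpha^{\vee}=\sum_{y\in X,\ \alpha\subseteq y}\widehat y$. *)

theory Defs
  imports Complex_Main "HOL-Library.Cardinality"
begin

text \<open>The space \<open>\<complex>\<^sup>X\<close> is represented by the complex functions that vanish outside \<open>X\<close>. A square
  matrix with rows and columns indexed by \<open>X\<close> is a binary function, of which only the entries
  in \<open>X \<times> X\<close> matter.\<close>

definition cvecs :: "'i set \<Rightarrow> ('i \<Rightarrow> complex) set" where
  "cvecs X = {f. \<forall>y. y \<notin> X \<longrightarrow> f y = 0}"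

definition mat_vec :: "'i set \<Rightarrow> ('i \<Rightarrow> 'i \<Rightarrow> complex) \<Rightarrow> ('i \<Rightarrow> complex) \<Rightarrow> 'i \<Rightarrow> complex" where
  "mat_vec X M f = (\<lambda>y. if y \<in> X then (\<Sum>z\<in>X. M y z * f z) else 0)"

definition hermitian_inner :: "'i set \<Rightarrow> ('i \<Rightarrow> complex) \<Rightarrow> ('i \<Rightarrow> complex) \<Rightarrow> complex" where
  "hermitian_inner X f g = (\<Sum>y\<in>X. f y * cnj (g y))"

definition eigenspace :: "'i set \<Rightarrow> ('i \<Rightarrow> 'i \<Rightarrow> complex) \<Rightarrow> complex \<Rightarrow> ('i \<Rightarrow> complex) set" where
  "eigenspace X M t = {f \<in> cvecs X. mat_vec X M f = (\<lambda>y. t * f y)}"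

definition is_eigenvalue :: "'i set \<Rightarrow> ('i \<Rightarrow> 'i \<Rightarrow> complex) \<Rightarrow> complex \<Rightarrow> bool" where
  "is_eigenvalue X M t \<longleftrightarrow> (\<exists>f \<in> eigenspace X M t. f \<noteq> (\<lambda>_. 0))"

text \<open>The \<open>i\<close>-th entry, counting from \<open>0\<close>, of the strictly decreasing list of the distinct real
  eigenvalues; meant for Hermitian \<open>M\<close>, all of whose eigenvalues are real.\<close>

definition ordered_eigenvalue :: "'i set \<Rightarrow> ('i \<Rightarrow> 'i \<Rightarrow> complex) \<Rightarrow> nat \<Rightarrow> real" where
  "ordered_eigenvalue X M i =
     rev (sorted_list_of_set {r. is_eigenvalue X M (complex_of_real r)}) ! i"

text \<open>The first conjunct only normalises the irrelevant entries, so that the matrix is unique.\<close>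

definition orthogonal_projection ::
  "'i set \<Rightarrow> ('i \<Rightarrow> complex) set \<Rightarrow> 'i \<Rightarrow> 'i \<Rightarrow> complex" where
  "orthogonal_projection X W = (THE E.
     (\<forall>y z. y \<notin> X \<or> z \<notin> X \<longrightarrow> E y z = 0) \<and>
     (\<forall>f \<in> cvecs X. mat_vec X E f \<in> W \<and>
        (\<forall>g \<in> W. hermitian_inner X (\<lambda>y. f y - mat_vec X E f y) g = 0)))"

text \<open>The Grassmann graph \<open>J\<^sub>q(N,D)\<close> of a vector space with scalar multiplication \<open>scale\<close>;
  \<open>q\<close> and \<open>N\<close> are determined by \<open>scale\<close>.\<close>

definition grassmann_vertices ::
  "('f::field \<Rightarrow> 'v::ab_group_add \<Rightarrow> 'v) \<Rightarrow> nat \<Rightarrow> 'v set set" where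
  "grassmann_vertices scale D = {y. module.subspace scale y \<and> vector_space.dim scale y = D}"

definition grassmann_adjacency ::
  "('f::field \<Rightarrow> 'v::ab_group_add \<Rightarrow> 'v) \<Rightarrow> nat \<Rightarrow> 'v set \<Rightarrow> 'v set \<Rightarrow> complex" where
  "grassmann_adjacency scale D y z =
     (if y \<in> grassmann_vertices scale D \<and> z \<in> grassmann_vertices scale D
         \<and> vector_space.dim scale (y \<inter> z) = D - 1 then 1 else 0)"

definition primitive_idempotent ::
  "('f::field \<Rightarrow> 'v::ab_group_add \<Rightarrow> 'v) \<Rightarrow> nat \<Rightarrow> nat \<Rightarrow> 'v set \<Rightarrow> 'v set \<Rightarrow> complex" where
  "primitive_idempotent scale D i =
     (let X = grassmann_vertices scale D; A = grassmann_adjacency scale D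
      in orthogonal_projection X
           (eigenspace X A (complex_of_real (ordered_eigenvalue X A i))))"

definition dual_adjacency ::
  "('f::field \<Rightarrow> 'v::ab_group_add \<Rightarrow> 'v) \<Rightarrow> nat \<Rightarrow> 'v set \<Rightarrow> 'v set \<Rightarrow> 'v set \<Rightarrow> complex" where
  "dual_adjacency scale D x y z =
     (if y = z
      then of_nat (card (grassmann_vertices scale D)) * primitive_idempotent scale D 1 x y
      else 0)"

definition q_int :: "nat \<Rightarrow> int \<Rightarrow> real" where
  "q_int q l = (real q powi l - 1) / (real q - 1)"

definition dual_eigenvalue :: "nat \<Rightarrow> nat \<Rightarrow> nat \<Rightarrow> nat \<Rightarrow> real" where
  "dual_eigenvalue q N D i =
     - (real q * q_int q (int N - 1) * (q_int q (int D) + q_int q (int N - int D)))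
         / ((real q - 1) * q_int q (int D) * q_int q (int N - int D))
     + (real q * q_int q (int N) * q_int q (int N - 1))
         / ((real q - 1) * q_int q (int D) * q_int q (int N - int D))
       * real q powi (- int i)"

definition covers ::
  "('f::field \<Rightarrow> 'v::ab_group_add \<Rightarrow> 'v) \<Rightarrow> 'v set \<Rightarrow> 'v set \<Rightarrow> bool" where
  "covers scale v u \<longleftrightarrow> module.subspace scale u \<and> module.subspace scale v \<and> u \<subseteq> v
     \<and> vector_space.dim scale v = vector_space.dim scale u + 1"

definition hat :: "'i \<Rightarrow> 'i \<Rightarrow> complex" where
  "hat y = (\<lambda>z. if z = y then 1 else 0)"

definition vee ::
  "('f::field \<Rightarrow> 'v::ab_group_add \<Rightarrow> 'v) \<Rightarrow> nat \<Rightarrow> 'v set \<Rightarrow> 'v set \<Rightarrow> complex" where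
  "vee scale D a = (\<lambda>z. \<Sum>y\<in>{y \<in> grassmann_vertices scale D. a \<subseteq> y}. hat y z)"

end

(* Call a one-dimensional subspace a point. An eigenvector of A with vanishing sum over the vertices
   through each point is pushed down, by summing over superspaces, from dimension d to dimension
   d - 1; since the up-down and down-up products differ from the adjacency matrices only by scalars,
   induction on d shows that its eigenvalue is below theta_1. Every other eigenvector has eigenvalue
   the valency or theta_1. Hence theta_1 is the second largest eigenvalue, and E_1 is an affine
   function of the Gram matrix of the point incidence vectors, so that |X| (E_1)_{x,y} is affine in
   the number [dim(x Int y)] of points of x Int y and equals theta*_{D - dim(x Int y)}. The theorem
   then reduces to counting the covers of alpha inside x Int y, of which there are
   [dim(x Int y) - i]. *)

theory Submission
  imports Defs
begin

subsection \<open>Projections and eigenvalues of matrices\<close>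

lemma of_nat_eq_of_real: "real n = r \<Longrightarrow> of_nat n = complex_of_real r"
  by auto

lemma eigenspace_diff:
  assumes "f \<in> eigenspace I M t" "g \<in> eigenspace I M t"
  shows "(\<lambda>y. f y - g y) \<in> eigenspace I M t"
proof -
  have "mat_vec I M (\<lambda>y. f y - g y) = (\<lambda>y. mat_vec I M f y - mat_vec I M g y)"
    by (auto simp: mat_vec_def right_diff_distrib sum_subtractf)
  then show ?thesis
    using assms by (simp add: eigenspace_def cvecs_def right_diff_distrib)
qed

lemma hermitian_inner_self_eq_0:
  assumes "finite I" "h \<in> cvecs I" "hermitian_inner I h h = 0"
  shows "h y = 0"
proof (cases "y \<in> I")
  case True
  have "of_real (\<Sum>y\<in>I. (cmod (h y))\<^sup>2) = hermitian_inner I h h"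
    by (simp add: hermitian_inner_def complex_norm_square del: of_real_power)
  then have "(\<Sum>y\<in>I. (cmod (h y))\<^sup>2) = 0"
    using assms(3) by (simp only: of_real_eq_0_iff)
  then show ?thesis using assms(1) True by (simp add: sum_nonneg_eq_0_iff)
qed (use assms(2) in \<open>simp add: cvecs_def\<close>)

text \<open>The difference of two candidate images lies in \<open>W\<close> and is orthogonal to
  itself, hence zero; applying both matrices to \<open>hat z\<close> then compares their
  columns.\<close>

lemma orthogonal_projection_eqI:
  assumes I: "finite I" and W: "W \<subseteq> cvecs I" "\<And>f g. f \<in> W \<Longrightarrow> g \<in> W \<Longrightarrow> (\<lambda>y. f y - g y) \<in> W"
    and zero: "\<And>y z. y \<notin> I \<or> z \<notin> I \<Longrightarrow> E y z = 0"
    and mem: "\<And>f. f \<in> cvecs I \<Longrightarrow> mat_vec I E f \<in> W"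
    and orth: "\<And>f g. f \<in> cvecs I \<Longrightarrow> g \<in> W \<Longrightarrow> hermitian_inner I (\<lambda>y. f y - mat_vec I E f y) g = 0"
  shows "orthogonal_projection I W = E"
  unfolding orthogonal_projection_def
proof (rule the_equality)
  fix F assume F: "(\<forall>y z. y \<notin> I \<or> z \<notin> I \<longrightarrow> F y z = 0) \<and>
     (\<forall>f \<in> cvecs I. mat_vec I F f \<in> W \<and>
        (\<forall>g \<in> W. hermitian_inner I (\<lambda>y. f y - mat_vec I F f y) g = 0))"
  have eq: "mat_vec I F f y = mat_vec I E f y" if f: "f \<in> cvecs I" for f y
  proof -
    let ?h = "\<lambda>y. mat_vec I F f y - mat_vec I E f y"
    have h: "?h \<in> W" using F f by (intro W(2) mem) auto
    have "hermitian_inner I ?h ?h = hermitian_inner I (\<lambda>y. f y - mat_vec I E f y) ?h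
        - hermitian_inner I (\<lambda>y. f y - mat_vec I F f y) ?h"
      by (simp add: hermitian_inner_def algebra_simps flip: sum_subtractf)
    also have "\<dots> = 0" using F f h orth by simp
    finally have "?h y = 0"
      using hermitian_inner_self_eq_0[OF I, of ?h y] h W(1) by blast
    then show ?thesis by simp
  qed
  have entry: "M y z = mat_vec I M (hat z) y" if "y \<in> I" "z \<in> I" for M y z
    using that I by (simp add: mat_vec_def hat_def if_distrib cong: if_cong)
  have "F y z = E y z" for y z
  proof (cases "y \<in> I \<and> z \<in> I")
    case True
    then have "hat z \<in> cvecs I" by (auto simp: cvecs_def hat_def)
    then show ?thesis using True entry[of y z F] entry[of y z E] eq by simp
  next
    case False
    then show ?thesis using F zero by auto
  qed
  then show "F = E" by blast
qed (use zero mem orth in blast)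

text \<open>Everything besides \<open>a\<close> and \<open>b\<close> lies below \<open>b\<close>, so
  the increasing list ends in \<open>b, a\<close>. This serves to read off theta_1 from
  \<open>ordered_eigenvalue\<close>.\<close>

lemma second_of_rev_sorted_list:
  fixes S :: "'a::linorder set"
  assumes "finite S" "a \<in> S" "b \<in> S" "b < a" "\<And>s. s \<in> S \<Longrightarrow> s = a \<or> s = b \<or> s < b"
  shows "rev (sorted_list_of_set S) ! 1 = b"
proof -
  let ?T = "S - {a, b}"
  have "sorted_list_of_set S = sorted_list_of_set ?T @ [b, a]"
  proof (rule sorted_list_of_set_unique[THEN iffD1])
    have "s < b" "s < a" if "s \<in> ?T" for s
      using assms(4) assms(5)[of s] that by (blast intro: less_trans)+
    moreover have "card {a, b} \<le> card S" using assms(1-3) by (intro card_mono) auto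
    ultimately show "sorted_wrt (<) (sorted_list_of_set ?T @ [b, a]) \<and>
        set (sorted_list_of_set ?T @ [b, a]) = S \<and>
        length (sorted_list_of_set ?T @ [b, a]) = card S"
      using assms(1-4) by (auto simp: sorted_wrt_append card_Diff_subset)
  qed (use assms in simp)
  then show ?thesis by simp
qed

subsection \<open>Counting subspaces over a finite field\<close>

locale finite_field_vector_space = finite_dimensional_vector_space scale Basis
  for scale :: "'f::{field,finite} \<Rightarrow> 'v::ab_group_add \<Rightarrow> 'v" and Basis +
  fixes q :: nat
  assumes q_eq: "q = CARD('f)"
begin

text \<open>Natural arguments keep computations within ordinary powers; \<open>q_int_of_nat\<close>
  translates.\<close>

definition qint :: "nat \<Rightarrow> real" where "qint m = (real q ^ m - 1) / (real q - 1)"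

abbreviation X :: "nat \<Rightarrow> 'v set set" where "X \<equiv> grassmann_vertices scale"

lemma q_gt_1: "real q > 1"
proof -
  have "card {0, 1 :: 'f} \<le> CARD('f)" by (rule card_mono) auto
  then show ?thesis by (simp add: q_eq)
qed

lemma q_int_of_nat: "q_int q (int m) = qint m"
  by (simp add: q_int_def qint_def)

lemma q_power_eq: "real q ^ m = (real q - 1) * qint m + 1"
  using q_gt_1 by (simp add: qint_def)

lemma qint_0 [simp]: "qint 0 = 0"
  by (simp add: qint_def)

lemma qint_1 [simp]: "qint (Suc 0) = 1"
  using q_gt_1 by (simp add: qint_def)

lemma qint_add: "qint (m + n) = qint m + real q ^ m * qint n"
  by (simp add: qint_def power_add right_diff_distrib flip: add_divide_distrib)

lemma qint_Suc: "qint (Suc m) = 1 + real q * qint m"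
  using qint_add[of 1 m] by simp

lemma qint_Suc': "qint (Suc m) = qint m + real q ^ m"
  using qint_add[of m 1] by simp

lemma qint_pos: "m > 0 \<Longrightarrow> qint m > 0"
  using q_gt_1 by (simp add: qint_def)

lemma in_X_iff: "y \<in> X d \<longleftrightarrow> subspace y \<and> dim y = d"
  by (simp add: grassmann_vertices_def)

text \<open>A further independent vector \<open>a\<close> multiplies the size of the span by that of
  the field, since each vector is uniquely \<open>s + scale k a\<close> with \<open>s\<close> in the
  old span.\<close>

lemma card_span_independent:
  assumes "finite B" "independent B"
  shows "finite (span B) \<and> card (span B) = CARD('f) ^ card B"
  using assms
proof (induction B)
  case empty
  then show ?case by simp
next
  case (insert a B)
  have a: "a \<notin> span B" and B: "independent B"
    using insert by (auto simp: independent_insert)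
  let ?f = "\<lambda>(k, s). s + scale k a"
  have "span (insert a B) = ?f ` (UNIV \<times> span B)"
  proof (intro equalityI subsetI)
    fix v assume "v \<in> span (insert a B)"
    then obtain k where "v - scale k a \<in> span B" by (auto simp: span_insert)
    then show "v \<in> ?f ` (UNIV \<times> span B)"
      by (intro image_eqI[of _ _ "(k, v - scale k a)"]) auto
  next
    fix v assume "v \<in> ?f ` (UNIV \<times> span B)"
    then obtain k s where "s \<in> span B" "v = s + scale k a" by auto
    then show "v \<in> span (insert a B)"
      by (auto simp: span_insert intro!: exI[of _ k])
  qed
  moreover have "inj_on ?f (UNIV \<times> span B)"
  proof (rule inj_onI, clarify)
    fix k s l t
    assume st: "s \<in> span B" "t \<in> span B" and eq: "s + scale k a = t + scale l a"
    have "scale (k - l) a = t - s"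
      using eq by (simp add: algebra_simps)
    then have "scale (k - l) a \<in> span B"
      using st by (simp add: span_diff)
    then have "k - l = 0"
      using a span_scale[of "scale (k - l) a" B "inverse (k - l)"] by (cases "k - l = 0") auto
    then show "k = l \<and> s = t" using eq by simp
  qed
  ultimately show ?case
    using insert B by (simp add: card_image card_cartesian_product)
qed

lemma finite_univ: "finite (UNIV :: 'v set)"
  using card_span_independent[OF finite_Basis independent_Basis] by (simp add: span_Basis)

lemma finite_vectors [simp]: "finite (S :: 'v set)"
  using finite_univ by (rule rev_finite_subset) simp

lemma finite_vector_sets [simp]: "finite (S :: 'v set set)"
proof -
  have "finite (UNIV :: 'v set set)"
    using finite_univ by (simp add: Finite_Set.finite_set)
  then show ?thesis by (rule rev_finite_subset) simp
qed

lemma card_subspace: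
  assumes "subspace S"
  shows "real (card S) = real q ^ dim S"
proof -
  obtain B where B: "B \<subseteq> S" "independent B" "S \<subseteq> span B" "card B = dim S"
    by (rule basis_exists)
  moreover have "span B = S"
    using B assms by (simp add: span_minimal subset_antisym)
  ultimately show ?thesis
    using card_span_independent[of B] by (simp add: q_eq)
qed

text \<open>A vector of \<open>y\<close> outside \<open>u\<close> lies in exactly one cover of
  \<open>u\<close>. So the sets \<open>w - u\<close> partition \<open>y - u\<close>, and each has
  size \<open>q ^ dim u * (q - 1)\<close>.\<close>

lemma card_covers_between:
  assumes u: "subspace u" and y: "subspace y" and uy: "u \<subseteq> y"
  shows "real (card {w. covers scale w u \<and> w \<subseteq> y}) = qint (dim y - dim u)"
proof -
  let ?C = "{w. covers scale w u \<and> w \<subseteq> y}"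
  have le: "dim u \<le> dim y" using uy by (rule dim_subset)
  have span_u: "span u = u" using u by simp
  have eq: "y - u = (\<Union>w\<in>?C. w - u)"
  proof (intro equalityI subsetI)
    fix v assume v: "v \<in> y - u"
    have "covers scale (span (insert v u)) u"
      using v u span_superset[of "insert v u"] dim_insert[of v u]
      by (simp add: covers_def span_u)
    moreover have "span (insert v u) \<subseteq> y"
      using v uy y by (intro span_minimal) auto
    moreover have "v \<in> span (insert v u)" by (simp add: span_base)
    ultimately show "v \<in> (\<Union>w\<in>?C. w - u)" using v by blast
  qed auto
  have span_eq: "w = span (insert v u)" if "w \<in> ?C" "v \<in> w - u" for w v
  proof (rule sym, rule subspace_dim_equal)
    show "subspace w" using that by (simp add: covers_def)
    then show "span (insert v u) \<subseteq> w"
      using that by (intro span_minimal) (auto simp: covers_def)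
    show "dim w \<le> dim (span (insert v u))"
      using that dim_insert[of v u] by (simp add: covers_def span_u)
  qed simp
  have "card (y - u) = (\<Sum>w\<in>?C. card (w - u))"
    unfolding eq by (rule card_UN_disjoint) (simp_all, use span_eq in blast)
  moreover have "real (card (w - u)) = real q ^ dim u * (real q - 1)" if "w \<in> ?C" for w
  proof -
    have *: "subspace w" "u \<subseteq> w" "dim w = dim u + 1"
      using that by (auto simp: covers_def)
    then have "card (w - u) = card w - card u" "card u \<le> card w"
      by (simp_all add: card_Diff_subset card_mono)
    then show ?thesis
      using * u by (simp add: of_nat_diff card_subspace algebra_simps)
  qed
  moreover have "real (card (y - u)) = real q ^ dim u * (real q ^ (dim y - dim u) - 1)"
  proof -
    have "card (y - u) = card y - card u" "card u \<le> card y"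
      using uy by (simp_all add: card_Diff_subset card_mono)
    then show ?thesis
      using le by (simp add: of_nat_diff card_subspace u y algebra_simps flip: power_add)
  qed
  ultimately have "real q ^ dim u * (real q ^ (dim y - dim u) - 1) =
      real q ^ dim u * (real (card ?C) * (real q - 1))"
    by auto
  then have "real q ^ (dim y - dim u) - 1 = real (card ?C) * (real q - 1)"
    using q_gt_1 by (subst (asm) mult_left_cancel) simp_all
  then show ?thesis
    using q_gt_1 by (simp add: qint_def)
qed

text \<open>Double counting of the flags \<open>u < v \<le> w \<le> y\<close> with \<open>v\<close> covering \<open>u\<close>, by induction on
  \<open>d - dim u\<close>.\<close>

lemma card_subspaces_between:
  assumes "subspace u" "subspace y" "u \<subseteq> y" "dim u \<le> d" "d \<le> dim y"
  shows "real (card {w \<in> X d. u \<subseteq> w \<and> w \<subseteq> y}) = (\<Prod>k=dim u..<d. qint (dim y - k) / qint (d - k))"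
  using assms
proof (induction "d - dim u" arbitrary: u)
  case 0
  then have d: "d = dim u" by simp
  have "{w \<in> X d. u \<subseteq> w \<and> w \<subseteq> y} = {u}"
  proof (intro equalityI subsetI)
    fix w assume "w \<in> {w \<in> X d. u \<subseteq> w \<and> w \<subseteq> y}"
    then show "w \<in> {u}"
      using subspace_dim_equal[of u w] 0(2) by (auto simp: in_X_iff d)
  qed (use 0 d in \<open>auto simp: in_X_iff\<close>)
  then show ?case by (simp add: d)
next
  case (Suc m)
  let ?W = "\<lambda>u. {w \<in> X d. u \<subseteq> w \<and> w \<subseteq> y}" and ?C = "{v. covers scale v u \<and> v \<subseteq> y}"
  have lt: "dim u < d" using Suc(2) by simp
  have "(\<Sum>v\<in>?C. real (card (?W v))) = (\<Sum>v\<in>?C. \<Sum>w | w \<in> ?W u \<and> v \<subseteq> w. 1)"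
    by (intro sum.cong refl) (auto intro!: arg_cong[where f = card] simp: covers_def)
  also have "\<dots> = (\<Sum>w\<in>?W u. \<Sum>v | v \<in> ?C \<and> v \<subseteq> w. 1)"
    by (rule sum.swap_restrict) simp_all
  also have "\<dots> = (\<Sum>w\<in>?W u. qint (d - dim u))"
  proof (rule sum.cong)
    fix w assume w: "w \<in> ?W u"
    then have "{v. v \<in> ?C \<and> v \<subseteq> w} = {v. covers scale v u \<and> v \<subseteq> w}" by auto
    then show "(\<Sum>v | v \<in> ?C \<and> v \<subseteq> w. 1) = qint (d - dim u)"
      using card_covers_between[of u w] w Suc.prems by (simp add: in_X_iff)
  qed simp
  also have "(\<Sum>v\<in>?C. real (card (?W v))) =
      (\<Sum>v\<in>?C. \<Prod>k=Suc (dim u)..<d. qint (dim y - k) / qint (d - k))"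
  proof (rule sum.cong)
    fix v assume v: "v \<in> ?C"
    have "real (card (?W v)) = (\<Prod>k=dim v..<d. qint (dim y - k) / qint (d - k))"
      using v Suc(2) Suc.prems by (intro Suc(1)) (auto simp: covers_def)
    then show "real (card (?W v)) = (\<Prod>k=Suc (dim u)..<d. qint (dim y - k) / qint (d - k))"
      using v by (simp add: covers_def)
  qed simp
  finally have "qint (dim y - dim u) * (\<Prod>k=Suc (dim u)..<d. qint (dim y - k) / qint (d - k))
      = real (card (?W u)) * qint (d - dim u)"
    using card_covers_between[of u y] Suc.prems by simp
  moreover have "qint (d - dim u) > 0" using lt by (simp add: qint_pos)
  ultimately show ?case
    using lt by (simp add: prod.atLeast_Suc_lessThan field_simps)
qed

text \<open>The product in \<open>card_subspaces_between\<close> telescopes here, numerators and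
  denominators being shifted by one.\<close>

lemma card_hyperplanes_between:
  assumes "subspace u" "subspace y" "u \<subseteq> y" "dim y = Suc d" "dim u \<le> d"
  shows "real (card {w \<in> X d. u \<subseteq> w \<and> w \<subseteq> y}) = qint (Suc d - dim u)"
proof -
  have "real (card {w \<in> X d. u \<subseteq> w \<and> w \<subseteq> y}) = (\<Prod>k=dim u..<d. qint (Suc d - k) / qint (d - k))"
    using card_subspaces_between[of u y d] assms by simp
  also have "\<dots> = qint (Suc d - dim u)"
    using assms(5)
  proof (induction rule: inc_induct)
    case base
    then show ?case by simp
  next
    case (step n)
    then have "qint (d - n) > 0" by (simp add: qint_pos)
    moreover have "(\<Prod>k=n..<d. qint (Suc d - k) / qint (d - k)) =
        qint (Suc d - n) / qint (d - n) * qint (Suc d - Suc n)"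
      using step.IH step.hyps by (simp only: prod.atLeast_Suc_lessThan)
    ultimately show ?case by simp
  qed
  finally show ?thesis .
qed

lemma card_superspaces:
  assumes "subspace u" "dim u < dimension"
  shows "real (card {w \<in> X (Suc (dim u)). u \<subseteq> w}) = qint (dimension - dim u)"
proof -
  have "{w \<in> X (Suc (dim u)). u \<subseteq> w} = {w. covers scale w u \<and> w \<subseteq> UNIV}"
    using assms by (auto simp: in_X_iff covers_def)
  then show ?thesis
    using card_covers_between[of u UNIV] assms by (simp add: dimension_def)
qed

subsection \<open>The spectrum of the Grassmann graph\<close>

abbreviation A :: "nat \<Rightarrow> 'v set \<Rightarrow> 'v set \<Rightarrow> complex" where "A \<equiv> grassmann_adjacency scale"

text \<open>The two largest eigenvalues of \<open>A d\<close> turn out to be \<open>valency d\<close> and \<open>\<theta> d\<close>.\<close>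

definition \<theta> :: "nat \<Rightarrow> real" where
  "\<theta> d = real q * qint (dimension - d) * qint (d - 1) - qint d"

definition valency :: "nat \<Rightarrow> real" where
  "valency d = real q * qint d * qint (dimension - d)"

lemma vee_apply: "vee scale d a y = (if y \<in> X d \<and> a \<subseteq> y then 1 else 0)"
  by (auto simp: vee_def hat_def)

lemma dim_le_dimension: "y \<in> X d \<Longrightarrow> d \<le> dimension"
  using dim_subset_UNIV by (auto simp: in_X_iff)

lemma dim_Int_less:
  assumes "y \<in> X d" "z \<in> X d" "y \<noteq> z"
  shows "dim (y \<inter> z) < d"
proof (rule ccontr)
  assume "\<not> dim (y \<inter> z) < d"
  then have "d \<le> dim (y \<inter> z)" by simp
  then have "y \<inter> z = y" "y \<inter> z = z"
    using assms by (intro subspace_dim_equal; simp add: in_X_iff subspace_inter)+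
  then show False using assms(3) by metis
qed

lemma sums_subset_iff:
  assumes "subspace u" "subspace v" "subspace w"
  shows "{a + b |a b. a \<in> u \<and> b \<in> v} \<subseteq> w \<longleftrightarrow> u \<subseteq> w \<and> v \<subseteq> w"
proof
  let ?s = "{a + b |a b. a \<in> u \<and> b \<in> v}"
  assume *: "?s \<subseteq> w"
  have "a \<in> ?s" if "a \<in> u" for a
    using that subspace_0[OF assms(2)] by (intro CollectI exI[of _ a] exI[of _ 0]) simp
  moreover have "a \<in> ?s" if "a \<in> v" for a
    using that subspace_0[OF assms(1)] by (intro CollectI exI[of _ 0] exI[of _ a]) simp
  ultimately show "u \<subseteq> w \<and> v \<subseteq> w" using * by blast
next
  assume "u \<subseteq> w \<and> v \<subseteq> w"
  then show "{a + b |a b. a \<in> u \<and> b \<in> v} \<subseteq> w" using assms(3) by (auto intro: subspace_add)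
qed

text \<open>By the dimension formula the hypothesis bounds \<open>e\<close> by the dimension of the
  sum of \<open>u\<close> and \<open>v\<close>; hence only that sum can have dimension
  \<open>e\<close> and contain both.\<close>

lemma card_common_superspaces:
  assumes u: "subspace u" and v: "subspace v" and le: "e + dim (u \<inter> v) \<le> dim u + dim v"
  shows "card {w \<in> X e. u \<subseteq> w \<and> v \<subseteq> w} = (if e + dim (u \<inter> v) = dim u + dim v then 1 else 0)"
proof -
  let ?s = "{a + b |a b. a \<in> u \<and> b \<in> v}"
  have s: "subspace ?s" "dim ?s + dim (u \<inter> v) = dim u + dim v"
    using u v by (rule subspace_sums, intro dim_sums_Int)
  have "{w \<in> X e. u \<subseteq> w \<and> v \<subseteq> w} = {w \<in> X e. ?s \<subseteq> w}"
    by (intro Collect_cong conj_cong refl) (simp only: in_X_iff sums_subset_iff[OF u v])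
  also have "\<dots> = (if dim ?s = e then {?s} else {})"
  proof -
    have "w = ?s \<and> dim ?s = e" if "w \<in> X e" "?s \<subseteq> w" for w
      using subspace_dim_equal[of ?s w] dim_subset[of ?s w] that s le by (auto simp: in_X_iff)
    then show ?thesis using s(1) by (auto simp: in_X_iff)
  qed
  finally show ?thesis using s(2) by auto
qed

section \<open>Up-down and down-up products of the inclusion matrices\<close>

lemma adjacency_self: "d \<ge> 1 \<Longrightarrow> A d y y = 0"
  \<comment> \<open>For \<open>d = 0\<close> the truncated \<open>d - 1\<close> is \<open>0\<close>,
    which would make the zero subspace adjacent to itself.\<close>
  by (auto simp: grassmann_adjacency_def in_X_iff)

lemma adjacency_sym: "A d y z = A d z y"
  by (auto simp: grassmann_adjacency_def Int_commute)

text \<open>Distinct \<open>y\<close> and \<open>z\<close> can share only the hyperplane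
  \<open>y \<inter> z\<close>, and do so exactly when adjacent; on the diagonal all hyperplanes of
  \<open>y\<close> count.\<close>

lemma card_common_hyperplanes:
  assumes "y \<in> X (Suc d)" "z \<in> X (Suc d)"
  shows "of_nat (card {w \<in> X d. w \<subseteq> y \<and> w \<subseteq> z}) =
    A (Suc d) y z + (if y = z then of_real (qint (Suc d)) else 0)"
proof (cases "y = z")
  case True
  have "{w \<in> X d. w \<subseteq> y} = {w \<in> X d. {0} \<subseteq> w \<and> w \<subseteq> y}"
    by (auto simp: in_X_iff subspace_0)
  then have "real (card {w \<in> X d. w \<subseteq> y}) = qint (Suc d)"
    using card_hyperplanes_between[of "{0}" y d] assms by (simp add: in_X_iff subspace_0)
  then show ?thesis
    using True by (simp add: adjacency_self of_nat_eq_of_real)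
next
  case False
  have lt: "dim (y \<inter> z) < Suc d" using dim_Int_less[OF assms False] .
  have sub: "subspace (y \<inter> z)" using assms by (simp add: in_X_iff subspace_inter)
  have "{w \<in> X d. w \<subseteq> y \<and> w \<subseteq> z} = (if dim (y \<inter> z) = d then {y \<inter> z} else {})"
  proof -
    have eq: "w = y \<inter> z \<and> dim (y \<inter> z) = d" if "w \<in> X d" "w \<subseteq> y" "w \<subseteq> z" for w
      using subspace_dim_equal[of w "y \<inter> z"] dim_subset[of w "y \<inter> z"] that lt sub
      by (auto simp: in_X_iff)
    show ?thesis
    proof (intro equalityI subsetI)
      fix w assume "w \<in> {w \<in> X d. w \<subseteq> y \<and> w \<subseteq> z}"
      then show "w \<in> (if dim (y \<inter> z) = d then {y \<inter> z} else {})"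
        using eq[of w] by simp
    qed (use sub in \<open>simp add: in_X_iff split: if_splits\<close>)
  qed
  then show ?thesis using False assms by (simp add: grassmann_adjacency_def)
qed

text \<open>Distinct \<open>y\<close> and \<open>z\<close> can only have their sum as common cover,
  and its dimension is \<open>Suc d\<close> exactly when they are adjacent.\<close>

lemma card_common_covers:
  assumes "y \<in> X d" "z \<in> X d" "d \<ge> 1" "d < dimension"
  shows "of_nat (card {w \<in> X (Suc d). y \<subseteq> w \<and> z \<subseteq> w}) =
    A d y z + (if y = z then of_real (qint (dimension - d)) else 0)"
proof (cases "y = z")
  case True
  have "real (card {w \<in> X (Suc d). y \<subseteq> w}) = qint (dimension - d)"
    using card_superspaces[of y] assms by (auto simp: in_X_iff)
  then show ?thesis
    using True assms(3) by (simp add: adjacency_self of_nat_eq_of_real)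
next
  case False
  have "dim (y \<inter> z) < d" using dim_Int_less[OF assms(1,2) False] .
  then have "card {w \<in> X (Suc d). y \<subseteq> w \<and> z \<subseteq> w} = (if dim (y \<inter> z) = d - 1 then 1 else 0)"
    using card_common_superspaces[of y z "Suc d"] assms by (auto simp: in_X_iff)
  then show ?thesis using False assms by (simp add: grassmann_adjacency_def)
qed

text \<open>Exchanging the sums weights \<open>f z\<close> by the number of common hyperplanes of
  \<open>y\<close> and \<open>z\<close>; \<open>sum_over_covers\<close> treats the opposite order of
  composition.\<close>

lemma sum_over_hyperplanes:
  assumes "y \<in> X (Suc d)"
  shows "(\<Sum>w | w \<in> X d \<and> w \<subseteq> y. \<Sum>z | z \<in> X (Suc d) \<and> w \<subseteq> z. f z) =
    mat_vec (X (Suc d)) (A (Suc d)) f y + of_real (qint (Suc d)) * f y"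
proof -
  have "(\<Sum>w | w \<in> X d \<and> w \<subseteq> y. \<Sum>z | z \<in> X (Suc d) \<and> w \<subseteq> z. f z) =
      (\<Sum>z\<in>X (Suc d). \<Sum>w | w \<in> {w. w \<in> X d \<and> w \<subseteq> y} \<and> w \<subseteq> z. f z)"
    by (rule sum.swap_restrict) simp_all
  also have "\<dots> = (\<Sum>z\<in>X (Suc d). of_nat (card {w \<in> X d. w \<subseteq> y \<and> w \<subseteq> z}) * f z)"
    by (simp add: conj_assoc)
  also have "\<dots> = (\<Sum>z\<in>X (Suc d). A (Suc d) y z * f z
      + (if y = z then of_real (qint (Suc d)) * f z else 0))"
    by (intro sum.cong refl) (simp add: card_common_hyperplanes[OF assms] distrib_right)
  also have "\<dots> = mat_vec (X (Suc d)) (A (Suc d)) f y + of_real (qint (Suc d)) * f y"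
    using assms by (simp add: sum.distrib mat_vec_def)
  finally show ?thesis .
qed

lemma sum_over_covers:
  assumes "y \<in> X d" "d \<ge> 1" "d < dimension"
  shows "(\<Sum>w | w \<in> X (Suc d) \<and> y \<subseteq> w. \<Sum>z | z \<in> X d \<and> z \<subseteq> w. f z) =
    mat_vec (X d) (A d) f y + of_real (qint (dimension - d)) * f y"
proof -
  have "(\<Sum>w | w \<in> X (Suc d) \<and> y \<subseteq> w. \<Sum>z | z \<in> X d \<and> z \<subseteq> w. f z) =
      (\<Sum>z\<in>X d. \<Sum>w | w \<in> {w. w \<in> X (Suc d) \<and> y \<subseteq> w} \<and> z \<subseteq> w. f z)"
    by (rule sum.swap_restrict) simp_all
  also have "\<dots> = (\<Sum>z\<in>X d. of_nat (card {w \<in> X (Suc d). y \<subseteq> w \<and> z \<subseteq> w}) * f z)"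
    by (simp add: conj_assoc)
  also have "\<dots> = (\<Sum>z\<in>X d. A d y z * f z
      + (if y = z then of_real (qint (dimension - d)) * f z else 0))"
    by (intro sum.cong refl) (simp add: card_common_covers[OF assms(1) _ assms(2,3)] distrib_right)
  also have "\<dots> = mat_vec (X d) (A d) f y + of_real (qint (dimension - d)) * f y"
    using assms by (simp add: sum.distrib mat_vec_def)
  finally show ?thesis .
qed

lemma point_Int:
  assumes p: "p \<in> X 1" and w: "subspace w" and "\<not> p \<subseteq> w"
  shows "dim (p \<inter> w) = 0"
proof (rule ccontr)
  assume "dim (p \<inter> w) \<noteq> 0"
  then have "dim p \<le> dim (p \<inter> w)" using p by (simp add: in_X_iff del: dim_eq_0)
  then have "p \<inter> w = p"
    using p w by (intro subspace_dim_equal) (auto simp: in_X_iff intro: subspace_inter)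
  then show False using assms(3) by blast
qed

lemma card_hyperplanes_through_point:
  assumes y: "y \<in> X (Suc d)" and p: "p \<in> X 1"
  shows "real (card {w \<in> X d. p \<subseteq> w \<and> w \<subseteq> y}) = (if p \<subseteq> y then qint d else 0)"
proof (cases "p \<subseteq> y \<and> d \<ge> 1")
  case True
  then show ?thesis
    using card_hyperplanes_between[of p y d] y p by (simp add: in_X_iff)
next
  case False
  \<comment> \<open>For \<open>d = 0\<close> no \<open>w\<close> contains a point, in agreement with
    \<open>qint 0 = 0\<close>.\<close>
  have "{w \<in> X d. p \<subseteq> w \<and> w \<subseteq> y} = {}"
    using False p dim_subset[of p] by (auto simp: in_X_iff)
  then show ?thesis using False by (auto simp: not_le)
qed

section \<open>The adjacency matrix on constant and point vectors\<close>

lemma mat_vec_one: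
  assumes "y \<in> X d" "d \<ge> 1"
  shows "mat_vec (X d) (A d) (\<lambda>_. 1) y = of_real (valency d)"
proof -
  obtain e where d: "d = Suc e" using assms(2) by (cases d) auto
  have y: "y \<in> X (Suc e)" using assms d by simp
  have lt: "e < dimension" using dim_le_dimension[OF assms(1)] d by simp
  have "(\<Sum>w | w \<in> X e \<and> w \<subseteq> y. \<Sum>z | z \<in> X (Suc e) \<and> w \<subseteq> z. 1) =
      (\<Sum>w | w \<in> X e \<and> w \<subseteq> y. complex_of_real (qint (dimension - e)))"
  proof (rule sum.cong)
    fix w assume "w \<in> {w. w \<in> X e \<and> w \<subseteq> y}"
    then show "(\<Sum>z | z \<in> X (Suc e) \<and> w \<subseteq> z. 1) = complex_of_real (qint (dimension - e))"
      using of_nat_eq_of_real[OF card_superspaces[of w]] lt by (auto simp: in_X_iff)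
  qed simp
  \<comment> \<open>The diagonal case of \<open>card_common_hyperplanes\<close> counts the
    hyperplanes of \<open>y\<close>.\<close>
  also have "\<dots> = of_real (qint (Suc e)) * of_real (qint (dimension - e))"
    using card_common_hyperplanes[OF y y] by (simp add: adjacency_self)
  finally have "mat_vec (X d) (A d) (\<lambda>_. 1) y =
      of_real (qint (Suc e) * (qint (dimension - e) - 1))"
    using sum_over_hyperplanes[OF y, of "\<lambda>_. 1"] by (simp add: d algebra_simps)
  also have "dimension - e = Suc (dimension - d)" using lt d by simp
  then have "qint (dimension - e) - 1 = real q * qint (dimension - d)" by (simp add: qint_Suc)
  finally show ?thesis by (simp add: valency_def d mult_ac)
qed

text \<open>\<open>sum_over_hyperplanes\<close> is applied to the vector of \<open>p\<close>. All
  superspaces of a hyperplane \<open>w\<close> contain \<open>p\<close> if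
  \<open>p \<subseteq> w\<close>; otherwise only the sum of \<open>w\<close> and \<open>p\<close>
  does.\<close>

lemma mat_vec_point_vee:
  assumes "y \<in> X d" "d \<ge> 1" and p: "p \<in> X 1"
  shows "mat_vec (X d) (A d) (vee scale d p) y =
    of_real (qint d) + of_real (\<theta> d) * vee scale d p y"
proof -
  obtain e where d: "d = Suc e" using assms(2) by (cases d) auto
  have y: "y \<in> X (Suc e)" using assms d by simp
  have lt: "e < dimension" using dim_le_dimension[OF assms(1)] d by simp
  let ?c = "qint (dimension - e) - 1"
  have "dimension - e = Suc (dimension - d)" using lt d by simp
  then have c: "?c = real q * qint (dimension - d)" by (simp add: qint_Suc)
  have "(\<Sum>w | w \<in> X e \<and> w \<subseteq> y. \<Sum>z | z \<in> X (Suc e) \<and> w \<subseteq> z. vee scale d p z) =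
      (\<Sum>w | w \<in> X e \<and> w \<subseteq> y. complex_of_real (1 + (if p \<subseteq> w then ?c else 0)))"
  proof (rule sum.cong)
    fix w assume w: "w \<in> {w. w \<in> X e \<and> w \<subseteq> y}"
    have "(\<Sum>z | z \<in> X (Suc e) \<and> w \<subseteq> z. vee scale d p z) =
        of_nat (card {z \<in> X (Suc e). w \<subseteq> z \<and> p \<subseteq> z})"
      by (simp add: vee_apply d sum.If_cases Int_def conj_ac)
    moreover have "real (card {z \<in> X (Suc e). w \<subseteq> z \<and> p \<subseteq> z}) = 1 + (if p \<subseteq> w then ?c else 0)"
    proof (cases "p \<subseteq> w")
      case True
      then have "{z \<in> X (Suc e). w \<subseteq> z \<and> p \<subseteq> z} = {z \<in> X (Suc e). w \<subseteq> z}" by auto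
      then show ?thesis using card_superspaces[of w] w lt True by (auto simp: in_X_iff)
    next
      case False
      then show ?thesis
        using card_common_superspaces[of w p "Suc e"] point_Int[of p w] w p
        by (simp add: in_X_iff Int_commute)
    qed
    ultimately show "(\<Sum>z | z \<in> X (Suc e) \<and> w \<subseteq> z. vee scale d p z) =
        complex_of_real (1 + (if p \<subseteq> w then ?c else 0))"
      by (simp only: of_nat_eq_of_real)
  qed simp
  also have "\<dots> = of_real (\<Sum>w | w \<in> X e \<and> w \<subseteq> y. 1 + (if p \<subseteq> w then ?c else 0))"
    by simp
  also have "(\<Sum>w | w \<in> X e \<and> w \<subseteq> y. 1 + (if p \<subseteq> w then ?c else 0)) =
      real (card {w \<in> X e. w \<subseteq> y}) + real (card {w \<in> X e. p \<subseteq> w \<and> w \<subseteq> y}) * ?c"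
    by (simp add: sum.distrib sum.If_cases Int_def conj_ac)
  also have "\<dots> = qint d + (if p \<subseteq> y then qint (d - 1) else 0) * ?c"
  proof -
    have "complex_of_real (real (card {w \<in> X e. w \<subseteq> y})) = of_real (qint d)"
      using card_common_hyperplanes[OF y y] by (simp add: adjacency_self d)
    then show ?thesis
      using card_hyperplanes_through_point[OF y p] by (simp only: of_real_eq_iff) (simp add: d)
  qed
  finally show ?thesis
    using sum_over_hyperplanes[OF y, of "vee scale d p"] y
    by (cases "p \<subseteq> y") (simp_all add: d vee_apply \<theta>_def c algebra_simps)
qed

section \<open>Eigenvectors with vanishing point sums\<close>

lemma sum_mult_mat_vec:
  "(\<Sum>y\<in>X d. f y * mat_vec (X d) (A d) g y) = (\<Sum>y\<in>X d. mat_vec (X d) (A d) f y * g y)"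
proof -
  have "(\<Sum>y\<in>X d. f y * mat_vec (X d) (A d) g y) = (\<Sum>y\<in>X d. \<Sum>z\<in>X d. f y * A d y z * g z)"
    by (simp add: mat_vec_def sum_distrib_left mult.assoc)
  also have "\<dots> = (\<Sum>z\<in>X d. \<Sum>y\<in>X d. f y * A d y z * g z)" by (rule sum.swap)
  also have "\<dots> = (\<Sum>y\<in>X d. mat_vec (X d) (A d) f y * g y)"
    by (simp add: mat_vec_def sum_distrib_right mult.commute[of "A d _ _"] adjacency_sym[of d])
  finally show ?thesis .
qed

text \<open>\<open>A d\<close> is symmetric, so \<open>g\<close> can be paired with the all-ones
  vector; unless \<open>t\<close> is the valency, the entries of \<open>g\<close> sum to
  zero.\<close>

lemma eigenvector_sum:
  assumes "g \<in> eigenspace (X d) (A d) t" "d \<ge> 1"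
  shows "t * (\<Sum>y\<in>X d. g y) = of_real (valency d) * (\<Sum>y\<in>X d. g y)"
proof -
  have "t * (\<Sum>y\<in>X d. g y) = (\<Sum>y\<in>X d. 1 * mat_vec (X d) (A d) g y)"
    using assms by (simp add: eigenspace_def sum_distrib_left)
  also have "\<dots> = (\<Sum>y\<in>X d. mat_vec (X d) (A d) (\<lambda>_. 1) y * g y)"
    by (rule sum_mult_mat_vec)
  also have "\<dots> = of_real (valency d) * (\<Sum>y\<in>X d. g y)"
    using assms(2) by (simp add: mat_vec_one sum_distrib_left)
  finally show ?thesis .
qed

text \<open>Pairing with the vector of \<open>p\<close>: once the entries of \<open>g\<close> sum to
  zero, its point sums vanish unless \<open>t = \<theta> d\<close>.\<close>

lemma eigenvector_point_sum:
  assumes "g \<in> eigenspace (X d) (A d) t" "d \<ge> 1" "p \<in> X 1"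
  shows "t * (\<Sum>y\<in>X d. vee scale d p y * g y) =
    of_real (qint d) * (\<Sum>y\<in>X d. g y) + of_real (\<theta> d) * (\<Sum>y\<in>X d. vee scale d p y * g y)"
proof -
  have "t * (\<Sum>y\<in>X d. vee scale d p y * g y) =
      (\<Sum>y\<in>X d. vee scale d p y * mat_vec (X d) (A d) g y)"
    using assms by (simp add: eigenspace_def sum_distrib_left mult_ac)
  also have "\<dots> = (\<Sum>y\<in>X d. mat_vec (X d) (A d) (vee scale d p) y * g y)"
    by (rule sum_mult_mat_vec)
  also have "\<dots> = (\<Sum>y\<in>X d. of_real (qint d) * g y + of_real (\<theta> d) * (vee scale d p y * g y))"
    using assms by (intro sum.cong refl) (simp add: mat_vec_point_vee algebra_simps)
  finally show ?thesis by (simp add: sum.distrib sum_distrib_left)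
qed

text \<open>For \<open>1 \<le> d < dimension\<close> these turn out to be all real eigenvalues but
  the two largest. The condition on point sums is preserved by the descent in dimension.\<close>

definition small_eigenvalues :: "nat \<Rightarrow> real set" where
  "small_eigenvalues d = {t. \<exists>h \<in> eigenspace (X d) (A d) (of_real t). h \<noteq> (\<lambda>_. 0) \<and>
     (\<forall>p\<in>X 1. (\<Sum>y\<in>X d. vee scale d p y * h y) = 0)}"

text \<open>In dimension one the vector of \<open>p\<close> has its only nonzero entry at
  \<open>p\<close>, so vanishing point sums force \<open>h = 0\<close>.\<close>

lemma small_eigenvalues_1: "small_eigenvalues 1 = {}"
proof -
  have "h p = 0" if h: "h \<in> cvecs (X 1)" "\<forall>p\<in>X 1. (\<Sum>y\<in>X 1. vee scale 1 p y * h y) = 0" for h p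
  proof (cases "p \<in> X 1")
    case True
    have "(\<Sum>y\<in>X 1. vee scale 1 p y * h y) = (\<Sum>y\<in>X 1. if y = p then h y else 0)"
    proof (intro sum.cong refl)
      fix y assume "y \<in> X 1"
      then show "vee scale 1 p y * h y = (if y = p then h y else 0)"
        using True subspace_dim_equal[of p y] by (auto simp: vee_apply in_X_iff)
    qed
    then show ?thesis using h True by simp
  qed (use h in \<open>simp add: cvecs_def\<close>)
  then show ?thesis by (auto simp: small_eigenvalues_def eigenspace_def)
qed

text \<open>Summing over superspaces maps an eigenvector on dimension \<open>d + 1\<close> either to \<open>0\<close> or to an
  eigenvector on dimension \<open>d\<close>, because \<open>sum_over_hyperplanes\<close> and \<open>sum_over_covers\<close> are the two
  orders of composing the up and down operators.\<close>

lemma small_eigenvalues_Suc: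
  assumes "d \<ge> 1" "d < dimension"
  shows "small_eigenvalues (Suc d) \<subseteq>
    insert (- qint (Suc d)) ((\<lambda>t. t + qint (dimension - d) - qint (Suc d)) ` small_eigenvalues d)"
proof
  fix t assume "t \<in> small_eigenvalues (Suc d)"
  then obtain h where h: "h \<in> eigenspace (X (Suc d)) (A (Suc d)) (of_real t)" and "h \<noteq> (\<lambda>_. 0)"
    and h0: "\<And>p. p \<in> X 1 \<Longrightarrow> (\<Sum>y\<in>X (Suc d). vee scale (Suc d) p y * h y) = 0"
    by (auto simp: small_eigenvalues_def)
  then obtain y0 where y0: "h y0 \<noteq> 0" by auto
  then have y0_X: "y0 \<in> X (Suc d)" using h by (auto simp: eigenspace_def cvecs_def)
  \<comment> \<open>The value \<open>0\<close> off \<open>X d\<close> puts \<open>g\<close> into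
    \<open>cvecs\<close>.\<close>
  define g where "g w = (if w \<in> X d then \<Sum>z | z \<in> X (Suc d) \<and> w \<subseteq> z. h z else 0)" for w
  have down: "(\<Sum>w | w \<in> X d \<and> w \<subseteq> y. g w) = of_real (t + qint (Suc d)) * h y"
    if "y \<in> X (Suc d)" for y
    using sum_over_hyperplanes[OF that, of h] h by (simp add: g_def eigenspace_def algebra_simps)
  show "t \<in> insert (- qint (Suc d))
      ((\<lambda>t. t + qint (dimension - d) - qint (Suc d)) ` small_eigenvalues d)"
  proof (cases "g = (\<lambda>_. 0)")
    case True
    then have "of_real (t + qint (Suc d)) * h y0 = 0" using down[OF y0_X] by simp
    then have "t + qint (Suc d) = 0" using y0 by (metis mult_eq_0_iff of_real_eq_0_iff)
    then show ?thesis by simp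
  next
    case False
    let ?s = "t + qint (Suc d) - qint (dimension - d)"
    have "mat_vec (X d) (A d) g w = of_real ?s * g w" for w
    proof (cases "w \<in> X d")
      case True
      have "mat_vec (X d) (A d) g w + of_real (qint (dimension - d)) * g w =
          (\<Sum>y | y \<in> X (Suc d) \<and> w \<subseteq> y. of_real (t + qint (Suc d)) * h y)"
        using sum_over_covers[OF True assms, of g] down by simp
      also have "\<dots> = of_real (t + qint (Suc d)) * g w"
        using True by (simp add: g_def sum_distrib_left)
      finally show ?thesis by (simp add: algebra_simps)
    qed (simp add: mat_vec_def g_def)
    then have "g \<in> eigenspace (X d) (A d) (of_real ?s)"
      by (auto simp: eigenspace_def cvecs_def g_def)
    \<comment> \<open>Point sums stay zero: \<open>h z\<close> is counted once for each hyperplane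
      of \<open>z\<close> through \<open>p\<close>, that is \<open>qint d\<close> times if
      \<open>p \<subseteq> z\<close> and never otherwise.\<close>
    moreover have "(\<Sum>w\<in>X d. vee scale d p w * g w) = 0" if p: "p \<in> X 1" for p
    proof -
      have "(\<Sum>w\<in>X d. vee scale d p w * g w) =
          (\<Sum>w\<in>X d. \<Sum>z | z \<in> X (Suc d) \<and> w \<subseteq> z. vee scale d p w * h z)"
        by (simp add: g_def sum_distrib_left)
      also have "\<dots> = (\<Sum>z\<in>X (Suc d). \<Sum>w | w \<in> X d \<and> w \<subseteq> z. vee scale d p w * h z)"
        by (rule sum.swap_restrict) simp_all
      also have "\<dots> = (\<Sum>z\<in>X (Suc d). of_real (qint d) * (vee scale (Suc d) p z * h z))"
      proof (intro sum.cong refl)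
        fix z assume z: "z \<in> X (Suc d)"
        have "(\<Sum>w | w \<in> X d \<and> w \<subseteq> z. vee scale d p w * h z) =
            of_real (real (card {w \<in> X d. p \<subseteq> w \<and> w \<subseteq> z})) * h z"
          by (simp add: vee_apply sum.If_cases Int_def conj_ac flip: sum_distrib_right)
        then show "(\<Sum>w | w \<in> X d \<and> w \<subseteq> z. vee scale d p w * h z) =
            of_real (qint d) * (vee scale (Suc d) p z * h z)"
          using card_hyperplanes_through_point[OF z p] z by (simp add: vee_apply)
      qed
      also have "\<dots> = 0" using h0[OF p] by (simp flip: sum_distrib_left)
      finally show ?thesis .
    qed
    ultimately have "?s \<in> small_eigenvalues d"
      using False unfolding small_eigenvalues_def by blast
    then show ?thesis by (intro insertI2 image_eqI[of _ _ ?s]) simp_all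
  qed
qed

text \<open>The shift in \<open>small_eigenvalues_Suc\<close> carries \<open>\<theta> d\<close>
  exactly to \<open>\<theta> (Suc d)\<close>, so the bound is inherited; the extra value
  \<open>- qint (Suc d)\<close> falls short of \<open>\<theta> (Suc d)\<close> by a positive
  product.\<close>

lemma small_eigenvalues_less:
  assumes "d \<ge> 1" "d < dimension"
  shows "finite (small_eigenvalues d) \<and> (\<forall>t\<in>small_eigenvalues d. t < \<theta> d)"
  using assms
proof (induction d rule: nat_induct_at_least)
  case base
  then show ?case using small_eigenvalues_1 by simp
next
  case (Suc d)
  have "dimension - d = Suc (dimension - Suc d)" using Suc.prems by simp
  then have N: "qint (dimension - d) = 1 + real q * qint (dimension - Suc d)"
    by (simp add: qint_Suc)
  have "d = Suc (d - 1)" using Suc.hyps by simp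
  then have d: "qint d = 1 + real q * qint (d - 1)" by (metis qint_Suc)
  have "\<theta> (Suc d) = \<theta> d + qint (dimension - d) - qint (Suc d)"
    by (simp add: \<theta>_def d N algebra_simps)
  moreover have "- qint (Suc d) < \<theta> (Suc d)"
    using Suc.hyps Suc.prems q_gt_1 by (simp add: \<theta>_def qint_pos)
  ultimately show ?case
    using small_eigenvalues_Suc[of d] Suc by (auto intro: finite_subset)
qed

subsection \<open>The first nontrivial idempotent\<close>

lemma card_points:
  assumes "subspace s"
  shows "real (card {p \<in> X 1. p \<subseteq> s}) = qint (dim s)"
proof -
  have "{p \<in> X 1. p \<subseteq> s} = {p. covers scale p {0} \<and> p \<subseteq> s}"
    by (auto simp: in_X_iff covers_def subspace_0)
  then show ?thesis
    using card_covers_between[of "{0}" s] assms by (simp add: subspace_0)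
qed

lemma sum_points_vee:
  assumes "y \<in> X d" "z \<in> X d"
  shows "(\<Sum>p\<in>X 1. vee scale d p y * vee scale d p z) = of_real (qint (dim (y \<inter> z)))"
proof -
  have "(\<Sum>p\<in>X 1. vee scale d p y * vee scale d p z) =
      (\<Sum>p\<in>X 1. if p \<subseteq> y \<inter> z then 1 else 0)"
    using assms by (intro sum.cong refl) (simp add: vee_apply)
  also have "\<dots> = of_nat (card {p \<in> X 1. p \<subseteq> y \<inter> z})"
    by (simp add: sum.If_cases Int_def)
  also have "\<dots> = of_real (qint (dim (y \<inter> z)))"
    using assms by (intro of_nat_eq_of_real card_points) (simp add: in_X_iff subspace_inter)
  finally show ?thesis .
qed

text \<open>The Gaussian binomial coefficient of \<open>dimension - j\<close> over
  \<open>d - j\<close>. The value \<open>0\<close> for \<open>j > d\<close> covers pairs of distinct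
  points when \<open>d = 1\<close>.\<close>

definition superspace_count :: "nat \<Rightarrow> nat \<Rightarrow> real" where
  "superspace_count d j =
     (if j \<le> d then \<Prod>k=j..<d. qint (dimension - k) / qint (d - k) else 0)"

lemma superspace_count_Suc:
  assumes "j \<le> d"
  shows "superspace_count d j * qint (d - j) = qint (dimension - j) * superspace_count d (Suc j)"
proof (cases "j = d")
  case False
  then have "j < d" "qint (d - j) > 0" using assms by (simp_all add: qint_pos)
  then show ?thesis
    by (simp add: superspace_count_def prod.atLeast_Suc_lessThan)
\<comment> \<open>At \<open>j = d\<close> both sides are zero, by \<open>qint 0 = 0\<close> and the
  default value.\<close>
qed (simp add: superspace_count_def)

lemma card_superspaces_of_dim:
  assumes "subspace u" "d \<le> dimension"
  shows "real (card {w \<in> X d. u \<subseteq> w}) = superspace_count d (dim u)"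
proof (cases "dim u \<le> d")
  case True
  then show ?thesis
    using card_subspaces_between[of u UNIV d] assms
    by (simp add: superspace_count_def dimension_def)
next
  case False
  then have "{w \<in> X d. u \<subseteq> w} = {}" using dim_subset[of u] by (auto simp: in_X_iff)
  then show ?thesis using False by (simp add: superspace_count_def)
qed

lemma card_X:
  assumes "d \<le> dimension"
  shows "real (card (X d)) = superspace_count d 0"
proof -
  have "X d = {w \<in> X d. {0} \<subseteq> w}" by (auto simp: in_X_iff subspace_0)
  then show ?thesis using card_superspaces_of_dim[of "{0}" d] assms by simp
qed

lemma card_X_pos:
  assumes "d \<le> dimension"
  shows "real (card (X d)) > 0"
  unfolding card_X[OF assms] superspace_count_def
  using assms by (auto intro!: prod_pos simp: qint_pos)

text \<open>Containing two distinct points means containing their sum, of dimension two; hence this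
  Gram matrix combines the identity and the all-ones matrix.\<close>

lemma sum_vee_vee:
  assumes p: "p \<in> X 1" "p' \<in> X 1" and d: "d \<le> dimension"
  shows "(\<Sum>y\<in>X d. vee scale d p y * vee scale d p' y) =
    of_real (if p = p' then superspace_count d 1 else superspace_count d 2)"
proof -
  have "(\<Sum>y\<in>X d. vee scale d p y * vee scale d p' y) =
      (\<Sum>y\<in>X d. if p \<subseteq> y \<and> p' \<subseteq> y then 1 else 0)"
    by (intro sum.cong refl) (simp add: vee_apply)
  also have "\<dots> = of_nat (card {y \<in> X d. p \<subseteq> y \<and> p' \<subseteq> y})"
    by (simp add: sum.If_cases Int_def)
  moreover have "real (card {y \<in> X d. p \<subseteq> y \<and> p' \<subseteq> y}) =
      (if p = p' then superspace_count d 1 else superspace_count d 2)"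
  proof (cases "p = p'")
    case True
    then show ?thesis using card_superspaces_of_dim[of p d] p d by (simp add: in_X_iff)
  next
    case False
    let ?s = "{a + b |a b. a \<in> p \<and> b \<in> p'}"
    have p': "subspace p" "subspace p'" "dim p = 1" "dim p' = 1"
      using p by (simp_all add: in_X_iff)
    have "dim (p \<inter> p') = 0" using dim_Int_less[OF p False] by linarith
    then have "dim ?s = 2" using dim_sums_Int[OF p'(1,2)] p' by linarith
    moreover have "{y \<in> X d. p \<subseteq> y \<and> p' \<subseteq> y} = {y \<in> X d. ?s \<subseteq> y}"
      using p' by (intro Collect_cong conj_cong refl) (simp add: in_X_iff sums_subset_iff)
    ultimately show ?thesis
      using card_superspaces_of_dim[of ?s d] False subspace_sums[OF p'(1,2)] d by simp
  qed
  ultimately show ?thesis by (simp only: of_nat_eq_of_real)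
qed

text \<open>The coefficient of the theorem for \<open>i = 0\<close>; also the factor with which |X|
  (E_1)_{x,y} depends on the number of points of \<open>x \<inter> y\<close>.\<close>

definition \<beta> :: "nat \<Rightarrow> real" where
  "\<beta> d = real q / real q ^ d * qint dimension * qint (dimension - 1)
     / (qint d * qint (dimension - d))"

text \<open>Up to a multiple of the all-ones matrix and a scalar, \<open>E1\<close> is the Gram matrix of the
  incidence vectors of points (one-dimensional subspaces). The constants are dictated by
  \<open>E1\<close> being idempotent and killing the constant vectors.\<close>

definition E1 :: "nat \<Rightarrow> 'v set \<Rightarrow> 'v set \<Rightarrow> complex" where
  "E1 d y z = (if y \<in> X d \<and> z \<in> X d
     then of_real (\<beta> d / card (X d) * (qint (dim (y \<inter> z)) - qint d ^ 2 / qint dimension)) else 0)"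

lemma qint_dimension: "d \<le> dimension \<Longrightarrow> qint dimension = qint d + real q ^ d * qint (dimension - d)"
  using qint_add[of d "dimension - d"] by simp

lemma valency_minus_\<theta>:
  assumes "1 \<le> d" "d \<le> dimension"
  shows "valency d - \<theta> d = qint dimension"
proof -
  have d: "Suc (d - 1) = d" using assms by simp
  have "qint d = qint (d - 1) + real q ^ (d - 1)"
    using qint_Suc'[of "d - 1"] unfolding d .
  moreover have "real q ^ d = real q * real q ^ (d - 1)"
    using power_Suc[of "real q" "d - 1"] unfolding d .
  ultimately show ?thesis
    by (simp add: valency_def \<theta>_def qint_dimension[OF assms(2)] algebra_simps)
qed

text \<open>For \<open>m = dim (x \<inter> y)\<close> the index \<open>d - m\<close> is the distance
  of \<open>x\<close> and \<open>y\<close>, and the right side is |X| times the entry of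
  \<open>E1\<close>.\<close>

lemma dual_eigenvalue_eq:
  assumes "1 \<le> d" "d < dimension" "m \<le> d"
  shows "dual_eigenvalue q dimension d (d - m) =
    \<beta> d * (qint m - qint d ^ 2 / qint dimension)"
proof -
  define a b c n n' where "a = qint d" and "b = qint (dimension - d)" and "c = qint m"
    and "n = qint dimension" and "n' = qint (dimension - 1)"
  define Q r u v where "Q = real q" and "r = real q - 1" and "u = real q ^ d" and "v = real q ^ m"
  have pos: "a > 0" "b > 0" "n > 0" "r > 0" "u > 0"
    using assms q_gt_1 by (simp_all add: a_def b_def n_def Q_def r_def u_def qint_pos)
  have "int dimension - 1 = int (dimension - 1)" "int dimension - int d = int (dimension - d)"
    using assms by (simp_all add: of_nat_diff)
  moreover have "real q powi - int (d - m) = v / u"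
    unfolding power_int_minus power_int_of_nat using assms q_gt_1
    by (simp add: power_diff u_def v_def)
  ultimately have "dual_eigenvalue q dimension d (d - m) =
      - (Q * n' * (a + b)) / (r * a * b) + Q * n * n' / (r * a * b) * (v / u)"
    unfolding dual_eigenvalue_def
    by (simp only: q_int_of_nat a_def b_def n_def n'_def Q_def r_def)
  also have "\<dots> = Q * n' / (r * a * b * u) * (n * v - (a + b) * u)"
    using pos by (simp add: field_simps)
  \<comment> \<open>Substituting \<open>n\<close> and \<open>v\<close> leaves
    \<open>r * n * c + a * (1 - u)\<close>, and \<open>1 - u = - r * a\<close>.\<close>
  also have "n * v - (a + b) * u = r * (n * c - a ^ 2)"
  proof -
    have "n = a + u * b" "u = r * a + 1" "v = r * c + 1"
      using qint_dimension[of d] q_power_eq assms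
      by (simp_all add: a_def b_def c_def n_def Q_def r_def u_def v_def)
    then show ?thesis by (simp add: algebra_simps power2_eq_square)
  qed
  also have "Q * n' / (r * a * b * u) * (r * (n * c - a ^ 2)) =
      Q / u * n * n' / (a * b) * (c - a ^ 2 / n)"
    using pos by (simp add: field_simps)
  finally show ?thesis
    by (simp add: \<beta>_def a_def b_def c_def n_def n'_def Q_def r_def u_def)
qed

section \<open>The columns of \<open>E1\<close>\<close>

lemma E1_eq:
  assumes "y \<in> X d" "z \<in> X d"
  shows "E1 d y z = of_real (\<beta> d / card (X d)) *
    ((\<Sum>p\<in>X 1. vee scale d p y * vee scale d p z) - of_real (qint d ^ 2 / qint dimension))"
  using assms by (simp add: E1_def sum_points_vee del: One_nat_def)

lemma E1_sym: "E1 d y z = E1 d z y"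
  by (simp add: E1_def Int_commute conj_commute)

lemma cnj_E1: "cnj (E1 d y z) = E1 d y z"
  by (simp add: E1_def)

lemma vee_idem: "vee scale d a y * vee scale d a y = vee scale d a y"
  by (simp add: vee_apply)

lemma sum_points_vee_self:
  assumes "z \<in> X d"
  shows "(\<Sum>p\<in>X 1. vee scale d p z) = of_real (qint d)"
  using sum_points_vee[OF assms assms] assms by (simp add: vee_idem in_X_iff del: One_nat_def)

text \<open>By \<open>mat_vec_point_vee\<close> the Gram part leaves a constant
  \<open>qint d ^ 2\<close>, as \<open>z\<close> has \<open>qint d\<close> points. The constant
  subtracted in \<open>E1\<close> cancels it because
  \<open>valency d - \<theta> d = qint dimension\<close>.\<close>

lemma mat_vec_E1_column:
  assumes y: "y \<in> X d" and z: "z \<in> X d" and d: "d \<ge> 1"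
  shows "mat_vec (X d) (A d) (\<lambda>y. E1 d y z) y = of_real (\<theta> d) * E1 d y z"
proof -
  define \<kappa> c where "\<kappa> = complex_of_real (\<beta> d / card (X d))" and "c = qint d ^ 2 / qint dimension"
  let ?v = "vee scale d"
  have le: "d \<le> dimension" using y by (rule dim_le_dimension)
  have n: "qint dimension > 0" using le d by (simp add: qint_pos)
  have "mat_vec (X d) (A d) (\<lambda>y. E1 d y z) y =
      (\<Sum>w\<in>X d. \<kappa> * ((\<Sum>p\<in>X 1. ?v p z * (A d y w * ?v p w)) - of_real c * (A d y w * 1)))"
    using y z by (simp add: mat_vec_def E1_eq \<kappa>_def c_def sum_distrib_left right_diff_distrib mult_ac)
  also have "\<dots> = \<kappa> * ((\<Sum>p\<in>X 1. ?v p z * mat_vec (X d) (A d) (?v p) y)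
      - of_real c * mat_vec (X d) (A d) (\<lambda>_. 1) y)"
    using y sum.swap[of "\<lambda>w p. ?v p z * (A d y w * ?v p w)" "X 1" "X d"]
    by (simp add: mat_vec_def sum_subtractf flip: sum_distrib_left)
  also have "\<dots> = \<kappa> * ((\<Sum>p\<in>X 1. of_real (qint d) * ?v p z + of_real (\<theta> d) * (?v p y * ?v p z))
      - of_real c * of_real (valency d))"
    using y d by (simp add: mat_vec_point_vee mat_vec_one algebra_simps)
  also have "\<dots> = \<kappa> * (of_real (qint d) * of_real (qint d)
      + of_real (\<theta> d) * (\<Sum>p\<in>X 1. ?v p y * ?v p z) - of_real c * of_real (valency d))"
    using z by (simp add: sum.distrib sum_points_vee_self del: One_nat_def flip: sum_distrib_left)
  also have "of_real c * of_real (valency d) =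
      complex_of_real (qint d) * of_real (qint d) + of_real (\<theta> d) * of_real c"
  proof -
    have "valency d = \<theta> d + qint dimension" using valency_minus_\<theta>[OF d le] by simp
    then have "c * valency d = qint d * qint d + \<theta> d * c"
      using n by (simp add: c_def field_simps power2_eq_square)
    then show ?thesis by (simp flip: of_real_mult of_real_add)
  qed
  finally show ?thesis
    using y z by (simp add: E1_eq \<kappa>_def c_def algebra_simps)
qed

text \<open>Up to constants \<open>E1\<close> fixes the vector of \<open>p\<close>, by the
  normalisation of \<open>\<beta>\<close>. The value of \<open>C\<close> is irrelevant later, when
  it multiplies a zero sum.\<close>

lemma point_sum_E1_column:
  assumes p: "p \<in> X 1" and d: "1 \<le> d" "d < dimension"
  obtains C where
    "\<And>z. z \<in> X d \<Longrightarrow> (\<Sum>y\<in>X d. vee scale d p y * E1 d y z) = vee scale d p z + C"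
proof -
  define K c where "K = card (X d)" and "c = qint d ^ 2 / qint dimension"
  define \<kappa> P1 P2 where "\<kappa> = \<beta> d / K" and "P1 = superspace_count d 1" and "P2 = superspace_count d 2"
  let ?v = "vee scale d"
  \<comment> \<open>\<open>superspace_count_Suc\<close> for \<open>j = 0\<close> and
    \<open>j = 1\<close> expresses both counts through \<open>K\<close>, which then cancels.\<close>
  have \<kappa>: "\<kappa> * (P1 - P2) = 1"
  proof -
    have K: "real K = superspace_count d 0" "real K > 0"
      using card_X[of d] card_X_pos[of d] d by (simp_all add: K_def)
    have pos: "qint d > 0" "qint dimension > 0" "qint (dimension - 1) > 0" "qint (dimension - d) > 0"
      using d by (auto intro!: qint_pos)
    have P1: "P1 = real K * qint d / qint dimension"
      using superspace_count_Suc[of 0 d] pos by (simp add: P1_def K(1) field_simps)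
    have "P1 * qint (d - 1) = qint (dimension - 1) * P2"
      using superspace_count_Suc[of 1 d] d by (simp add: P1_def P2_def numeral_2_eq_2)
    then have "P1 - P2 = P1 * (qint (dimension - 1) - qint (d - 1)) / qint (dimension - 1)"
      using pos by (simp add: field_simps)
    also have "qint (dimension - 1) - qint (d - 1) = real q ^ (d - 1) * qint (dimension - d)"
      using qint_add[of "d - 1" "dimension - d"] d by simp
    finally have *: "P1 - P2 = real K * qint d / qint dimension
        * (real q ^ (d - 1) * qint (dimension - d)) / qint (dimension - 1)"
      unfolding P1 .
    have "real q ^ d = real q * real q ^ (d - 1)"
      using d by (cases d) simp_all
    then show ?thesis
      using pos K(2) q_gt_1 unfolding * \<kappa>_def \<beta>_def by (simp add: field_simps)
  qed
  have "(\<Sum>y\<in>X d. ?v p y * E1 d y z) =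
      ?v p z + of_real (\<kappa> * (P2 * qint d - c * P1))" if z: "z \<in> X d" for z
  proof -
    have "(\<Sum>y\<in>X d. ?v p y * E1 d y z) =
        (\<Sum>y\<in>X d. of_real \<kappa> * ((\<Sum>p'\<in>X 1. ?v p' z * (?v p y * ?v p' y))
          - of_real c * (?v p y * ?v p y)))"
    proof (intro sum.cong refl)
      fix y assume y: "y \<in> X d"
      show "?v p y * E1 d y z = of_real \<kappa> * ((\<Sum>p'\<in>X 1. ?v p' z * (?v p y * ?v p' y))
          - of_real c * (?v p y * ?v p y))"
        using y z by (simp add: E1_eq \<kappa>_def K_def c_def sum_distrib_left right_diff_distrib
            vee_idem mult_ac)
    qed
    also have "\<dots> = of_real \<kappa> * ((\<Sum>p'\<in>X 1. ?v p' z * (\<Sum>y\<in>X d. ?v p y * ?v p' y))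
        - of_real c * (\<Sum>y\<in>X d. ?v p y * ?v p y))"
      using sum.swap[of "\<lambda>y p'. ?v p' z * (?v p y * ?v p' y)" "X 1" "X d"]
      by (simp add: sum_subtractf flip: sum_distrib_left)
    \<comment> \<open>The value \<open>P1\<close> at \<open>p' = p\<close> is split as
      \<open>P2 + (P1 - P2)\<close>.\<close>
    also have "\<dots> = of_real \<kappa> * ((\<Sum>p'\<in>X 1. of_real P2 * ?v p' z
        + (if p' = p then of_real (P1 - P2) * ?v p z else 0)) - of_real c * of_real P1)"
      using p d by (intro arg_cong2[where f = "(*)"] arg_cong2[where f = "(-)"] sum.cong refl)
        (auto simp: sum_vee_vee P1_def P2_def algebra_simps)
    also have "\<dots> = of_real (\<kappa> * (P1 - P2)) * ?v p z + of_real (\<kappa> * (P2 * qint d - c * P1))"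
      using p z by (simp add: sum.distrib sum_points_vee_self algebra_simps del: One_nat_def
          flip: sum_distrib_left)
    finally show ?thesis by (simp add: \<kappa>)
  qed
  then show thesis by (rule that)
qed

section \<open>Projection onto the second eigenspace\<close>

lemma mat_vec_E1_mem_eigenspace:
  assumes "d \<ge> 1"
  shows "mat_vec (X d) (E1 d) f \<in> eigenspace (X d) (A d) (of_real (\<theta> d))"
proof -
  have "mat_vec (X d) (A d) (mat_vec (X d) (E1 d) f) y = of_real (\<theta> d) * mat_vec (X d) (E1 d) f y" for y
  proof (cases "y \<in> X d")
    case True
    have "mat_vec (X d) (A d) (mat_vec (X d) (E1 d) f) y =
        (\<Sum>w\<in>X d. \<Sum>z\<in>X d. f z * (A d y w * E1 d w z))"
      using True by (simp add: mat_vec_def sum_distrib_left mult_ac)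
    also have "\<dots> = (\<Sum>z\<in>X d. f z * mat_vec (X d) (A d) (\<lambda>y. E1 d y z) y)"
      using True by (subst sum.swap) (simp add: mat_vec_def sum_distrib_left)
    also have "\<dots> = of_real (\<theta> d) * mat_vec (X d) (E1 d) f y"
      using True assms by (simp add: mat_vec_E1_column) (simp add: mat_vec_def sum_distrib_left mult_ac)
    finally show ?thesis .
  qed (simp add: mat_vec_def)
  then show ?thesis by (auto simp: eigenspace_def cvecs_def mat_vec_def)
qed

lemma eigenvector_sum_eq_0:
  assumes "g \<in> eigenspace (X d) (A d) (of_real t)" "1 \<le> d" "t \<noteq> valency d"
  shows "(\<Sum>y\<in>X d. g y) = 0"
  using eigenvector_sum[OF assms(1,2)] assms(3) by simp

text \<open>For an eigenvector \<open>g\<close>, the difference of \<open>g\<close> and its image under \<open>E1\<close> has vanishing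
  point sums, so if nonzero it would make \<open>\<theta> d\<close> one of the \<open>small_eigenvalues\<close>.\<close>

lemma mat_vec_E1_fixes_eigenspace:
  assumes g: "g \<in> eigenspace (X d) (A d) (of_real (\<theta> d))" and d: "1 \<le> d" "d < dimension"
  shows "mat_vec (X d) (E1 d) g = g"
proof (rule ccontr)
  assume ne: "mat_vec (X d) (E1 d) g \<noteq> g"
  let ?h = "\<lambda>y. g y - mat_vec (X d) (E1 d) g y"
  have h: "?h \<in> eigenspace (X d) (A d) (of_real (\<theta> d))"
    using g mat_vec_E1_mem_eigenspace[OF d(1)] by (rule eigenspace_diff)
  have "\<theta> d \<noteq> valency d"
    using valency_minus_\<theta>[of d] d qint_pos[of dimension] by auto
  \<comment> \<open>This disposes of the unspecified constant \<open>C\<close> below.\<close>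
  then have sum_g: "(\<Sum>y\<in>X d. g y) = 0" using eigenvector_sum_eq_0[OF g d(1)] by simp
  have "(\<Sum>y\<in>X d. vee scale d p y * ?h y) = 0" if p: "p \<in> X 1" for p
  proof -
    obtain C where C: "\<And>z. z \<in> X d \<Longrightarrow>
        (\<Sum>y\<in>X d. vee scale d p y * E1 d y z) = vee scale d p z + C"
      using point_sum_E1_column[OF p d] by blast
    have "(\<Sum>y\<in>X d. vee scale d p y * mat_vec (X d) (E1 d) g y) =
        (\<Sum>y\<in>X d. \<Sum>z\<in>X d. vee scale d p y * E1 d y z * g z)"
      by (simp add: mat_vec_def sum_distrib_left mult_ac)
    also have "\<dots> = (\<Sum>z\<in>X d. (\<Sum>y\<in>X d. vee scale d p y * E1 d y z) * g z)"
      by (subst sum.swap) (simp add: sum_distrib_right)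
    also have "\<dots> = (\<Sum>z\<in>X d. vee scale d p z * g z) + C * (\<Sum>z\<in>X d. g z)"
      by (simp add: C distrib_right sum.distrib sum_distrib_left)
    finally show ?thesis by (simp add: right_diff_distrib sum_subtractf sum_g)
  qed
  moreover have "?h \<noteq> (\<lambda>_. 0)" using ne[symmetric] by (auto simp: fun_eq_iff)
  ultimately have "\<theta> d \<in> small_eigenvalues d"
    using h unfolding small_eigenvalues_def by blast
  then show False using small_eigenvalues_less[OF d] by blast
qed

text \<open>Pairing with constant and point vectors leaves only \<open>valency d\<close>,
  \<open>\<theta> d\<close> and \<open>small_eigenvalues d\<close>. The first two do occur, on the
  all-ones vector and on a column of \<open>E1\<close>.\<close>

lemma ordered_eigenvalue_1:
  assumes d: "1 \<le> d" "d < dimension"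
  shows "ordered_eigenvalue (X d) (A d) 1 = \<theta> d"
proof -
  let ?S = "{r. is_eigenvalue (X d) (A d) (complex_of_real r)}"
  have n: "qint dimension > 0" using d by (simp add: qint_pos)
  then have lt: "\<theta> d < valency d" using valency_minus_\<theta>[of d] d by simp
  obtain x where x: "x \<in> X d" using card_X_pos[of d] d by (cases "X d = {}") auto
  have S: "s = valency d \<or> s = \<theta> d \<or> s \<in> small_eigenvalues d" if s: "s \<in> ?S" for s
  proof (cases "s = valency d \<or> s = \<theta> d")
    case False
    obtain g where g: "g \<in> eigenspace (X d) (A d) (of_real s)" "g \<noteq> (\<lambda>_. 0)"
      using s by (auto simp: is_eigenvalue_def)
    have "(\<Sum>y\<in>X d. vee scale d p y * g y) = 0" if "p \<in> X 1" for p
      using eigenvector_point_sum[OF g(1) d(1) that] eigenvector_sum_eq_0[OF g(1) d(1)] False by simp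
    then show ?thesis using g unfolding small_eigenvalues_def by blast
  qed blast
  have "valency d \<in> ?S"
  proof -
    \<comment> \<open>The all-ones vector, cut off outside \<open>X d\<close> as
      \<open>cvecs\<close> demands.\<close>
    define e where "e y = (if y \<in> X d then 1 else 0 :: complex)" for y
    have "mat_vec (X d) (A d) e y = of_real (valency d) * e y" for y
      using mat_vec_one[of y d] d by (auto simp: e_def mat_vec_def cong: sum.cong)
    then have "e \<in> eigenspace (X d) (A d) (of_real (valency d))"
      by (auto simp: eigenspace_def cvecs_def e_def)
    moreover have "e x \<noteq> 0" using x by (simp add: e_def)
    ultimately show ?thesis by (auto simp: is_eigenvalue_def fun_eq_iff)
  qed
  moreover have "\<theta> d \<in> ?S"
  proof -
    have "mat_vec (X d) (E1 d) (hat x) \<in> eigenspace (X d) (A d) (of_real (\<theta> d))"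
      using d(1) by (rule mat_vec_E1_mem_eigenspace)
    \<comment> \<open>The diagonal entry of \<open>E1\<close> is positive because
      \<open>qint d < qint dimension\<close>.\<close>
    moreover have "mat_vec (X d) (E1 d) (hat x) x \<noteq> 0"
    proof -
      have pos: "qint d > 0" "qint (dimension - 1) > 0" "qint (dimension - d) > 0"
        using d by (auto intro!: qint_pos)
      have "qint dimension > qint d"
        using qint_dimension[of d] d pos q_gt_1 by simp
      then have "qint d - qint d ^ 2 / qint dimension > 0"
        using pos n by (simp add: field_simps power2_eq_square)
      moreover have "\<beta> d > 0" using pos n q_gt_1 by (simp add: \<beta>_def)
      ultimately have "\<beta> d / card (X d) * (qint d - qint d ^ 2 / qint dimension) > 0"
        using card_X_pos[of d] d by simp
      moreover have "mat_vec (X d) (E1 d) (hat x) x = E1 d x x"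
        using x by (simp add: mat_vec_def hat_def if_distrib cong: if_cong)
      moreover have "dim x = d" using x by (simp add: in_X_iff)
      ultimately show ?thesis using x
        unfolding E1_def by (simp only: Int_absorb simp_thms if_True of_real_eq_0_iff)
    qed
    ultimately show ?thesis by (auto simp: is_eigenvalue_def fun_eq_iff)
  qed
  moreover have "finite ?S"
    using small_eigenvalues_less[OF d] S
    by (intro finite_subset[of ?S "insert (valency d) (insert (\<theta> d) (small_eigenvalues d))"]) auto
  ultimately show ?thesis
    unfolding ordered_eigenvalue_def
    using lt small_eigenvalues_less[OF d] S by (intro second_of_rev_sorted_list) blast+
qed

text \<open>\<open>E1\<close> is real symmetric, maps into the eigenspace and fixes it pointwise;
  hence every residual is orthogonal to the eigenspace.\<close>

lemma primitive_idempotent_1: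
  assumes d: "1 \<le> d" "d < dimension"
  shows "primitive_idempotent scale d 1 = E1 d"
proof -
  let ?W = "eigenspace (X d) (A d) (of_real (\<theta> d))"
  have "orthogonal_projection (X d) ?W = E1 d"
  proof (rule orthogonal_projection_eqI)
    fix f g assume g: "g \<in> ?W"
    have "(\<Sum>y\<in>X d. mat_vec (X d) (E1 d) f y * cnj (g y)) =
        (\<Sum>y\<in>X d. \<Sum>z\<in>X d. f z * cnj (E1 d z y * g y))"
      by (simp add: mat_vec_def sum_distrib_right sum_distrib_left cnj_E1 E1_sym[of d] mult_ac)
    also have "\<dots> = (\<Sum>z\<in>X d. f z * cnj (mat_vec (X d) (E1 d) g z))"
      by (subst sum.swap) (simp add: mat_vec_def sum_distrib_left)
    also have "\<dots> = (\<Sum>z\<in>X d. f z * cnj (g z))"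
      by (simp add: mat_vec_E1_fixes_eigenspace[OF g d])
    finally show "hermitian_inner (X d) (\<lambda>y. f y - mat_vec (X d) (E1 d) f y) g = 0"
      by (simp add: hermitian_inner_def left_diff_distrib sum_subtractf)
  next
    show "?W \<subseteq> cvecs (X d)" by (auto simp: eigenspace_def)
  qed (use d in \<open>auto simp: E1_def intro: eigenspace_diff mat_vec_E1_mem_eigenspace\<close>)
  then show ?thesis
    by (simp add: primitive_idempotent_def ordered_eigenvalue_1[OF d] del: One_nat_def)
qed

lemma mat_vec_dual_adjacency:
  "mat_vec (X d) (dual_adjacency scale d x) f y =
    (if y \<in> X d then of_nat (card (X d)) * primitive_idempotent scale d 1 x y * f y else 0)"
  by (simp add: mat_vec_def dual_adjacency_def if_distrib[of "\<lambda>t. t * _"] cong: if_cong)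

end

section \<open>Action of the dual adjacency matrix\<close>

theorem theorem8p4:
  fixes scale :: "'f::{field,finite} \<Rightarrow> 'v::ab_group_add \<Rightarrow> 'v"
    and N D q i :: nat and x \<alpha> :: "'v set"
  assumes "vector_space scale"
    and "vector_space.dim scale UNIV = N"
    and "q = CARD('f)"
    and "D \<ge> 1" and "N > 2 * D"
    and "x \<in> grassmann_vertices scale D"
    and "module.subspace scale \<alpha>" and "\<alpha> \<subseteq> x"
    and "i = vector_space.dim scale \<alpha>"
  shows "mat_vec (grassmann_vertices scale D) (dual_adjacency scale D x) (vee scale D \<alpha>) =
    (\<lambda>y. complex_of_real (dual_eigenvalue q N D (D - i)) * vee scale D \<alpha> y
       + complex_of_real (real q powi (- int D + int i + 1) * q_int q (int N) * q_int q (int N - 1)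
            / (q_int q (int D) * q_int q (int N - int D)))
         * (\<Sum>\<gamma>\<in>{\<gamma>. \<gamma> \<subseteq> x \<and> covers scale \<gamma> \<alpha>}. vee scale D \<gamma> y))"
proof -
  interpret vector_space scale by fact
  obtain B where B: "independent B" "UNIV \<subseteq> span B" "card B = dim UNIV"
    using basis_exists[of UNIV] by metis
  interpret finite_field_vector_space scale B q
  proof
    \<comment> \<open>The cardinality \<open>N\<close> of \<open>B\<close> is positive, whereas
      \<open>card\<close> of an infinite set is \<open>0\<close>.\<close>
    show "finite B" using B(3) assms(2,5) by (intro card_ge_0_finite) simp
  qed (use B assms(3) in auto)
  have N: "N = dimension" using assms(2) by (simp add: dimension_def)
  have D: "1 \<le> D" "D < dimension" using assms(4,5) N by simp_all
  have x: "subspace x" "dim x = D" using assms(6) by (simp_all add: in_X_iff)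
  have i: "i \<le> D" using dim_subset[OF assms(8)] assms(9) x by simp
  have coeff: "real q powi (- int D + int i + 1) * q_int q (int N) * q_int q (int N - 1)
      / (q_int q (int D) * q_int q (int N - int D)) = \<beta> D * real q ^ i"
  proof -
    have "int N - 1 = int (dimension - 1)" "int N - int D = int (dimension - D)"
      using D by (simp_all add: N of_nat_diff)
    moreover have "real q powi (- int D + int i + 1) = real q / real q ^ D * real q ^ i"
    proof -
      have *: "- int D + int i + 1 = int (Suc i) - int D" by simp
      show ?thesis unfolding * using q_gt_1 by (simp add: power_int_diff del: of_nat_Suc)
    qed
    ultimately show ?thesis by (simp only: \<beta>_def q_int_of_nat N) simp
  qed
  show ?thesis
    unfolding coeff
  proof
    fix y
    let ?G = "{\<gamma>. \<gamma> \<subseteq> x \<and> covers scale \<gamma> \<alpha>}"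
    show "mat_vec (X D) (dual_adjacency scale D x) (vee scale D \<alpha>) y =
      of_real (dual_eigenvalue q N D (D - i)) * vee scale D \<alpha> y
      + of_real (\<beta> D * real q ^ i) * (\<Sum>\<gamma>\<in>?G. vee scale D \<gamma> y)"
    proof (cases "y \<in> X D \<and> \<alpha> \<subseteq> y")
      case False
      \<comment> \<open>Every cover of \<open>\<alpha>\<close> contains \<open>\<alpha>\<close>, so
        both sides vanish at this \<open>y\<close>.\<close>
      have "\<alpha> \<subseteq> \<gamma>" if "\<gamma> \<in> ?G" for \<gamma> using that by (auto simp: covers_def)
      then have "vee scale D \<gamma> y = 0" if "\<gamma> \<in> ?G" for \<gamma> using False that by (auto simp: vee_apply)
      moreover have "vee scale D \<alpha> y = 0" using False by (auto simp: vee_apply)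
      ultimately show ?thesis by (simp add: mat_vec_dual_adjacency)
    next
      case True
      define m where "m = dim (x \<inter> y)"
      have y: "y \<in> X D" "\<alpha> \<subseteq> y" using True by auto
      have xy: "subspace (x \<inter> y)" "\<alpha> \<subseteq> x \<inter> y"
        using x y assms(8) by (auto simp: in_X_iff subspace_inter)
      have m: "i \<le> m" "m \<le> D"
        using dim_subset[OF xy(2)] dim_subset[of "x \<inter> y" x] x assms(9) by (simp_all add: m_def)
      have "mat_vec (X D) (dual_adjacency scale D x) (vee scale D \<alpha>) y =
          of_nat (card (X D)) * E1 D x y"
        using y by (simp add: mat_vec_dual_adjacency vee_apply primitive_idempotent_1[OF D]
            del: One_nat_def)
      also have "\<dots> = of_real (\<beta> D * (qint m - qint D ^ 2 / qint dimension))"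
        using assms(6) y by (auto simp: E1_def m_def)
      \<comment> \<open>The part \<open>qint i\<close> yields the dual eigenvalue of index
        \<open>D - i\<close>; the rest is \<open>q ^ i\<close> times the number of covers of
        \<open>\<alpha>\<close> inside \<open>x \<inter> y\<close>.\<close>
      also have "qint m = qint i + real q ^ i * qint (m - i)"
        using qint_add[of i "m - i"] m by simp
      also have "\<beta> D * (qint i + real q ^ i * qint (m - i) - qint D ^ 2 / qint dimension) =
          dual_eigenvalue q N D (D - i) + \<beta> D * real q ^ i * qint (m - i)"
        unfolding N dual_eigenvalue_eq[OF D i] by (simp add: algebra_simps)
      finally have "mat_vec (X D) (dual_adjacency scale D x) (vee scale D \<alpha>) y =
          of_real (dual_eigenvalue q N D (D - i)) + of_real (\<beta> D * real q ^ i) * of_real (qint (m - i))"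
        by simp
      moreover have "complex_of_real (qint (m - i)) = (\<Sum>\<gamma>\<in>?G. vee scale D \<gamma> y)"
      proof -
        have "(\<Sum>\<gamma>\<in>?G. vee scale D \<gamma> y) = of_nat (card {\<gamma> \<in> ?G. \<gamma> \<subseteq> y})"
          using y by (simp add: vee_apply sum.If_cases Int_def)
        also have "{\<gamma> \<in> ?G. \<gamma> \<subseteq> y} = {\<gamma>. covers scale \<gamma> \<alpha> \<and> \<gamma> \<subseteq> x \<inter> y}" by auto
        also have "of_nat (card \<dots>) = complex_of_real (qint (m - i))"
          using of_nat_eq_of_real[OF card_covers_between[OF assms(7) xy]] assms(9)
          by (simp add: m_def)
        finally show ?thesis by simp
      qed
      ultimately show ?thesis using y by (simp add: vee_apply)
    qed
  qed
qed

end
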